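(* Let $X,Y$ be Banach spaces and let $f:U\to Y$ be a map defined on an open subset $U\subset X$. Suppose that (1) the Banach space $X$ has modulus of convexity of power type 2; (2) $f$ is second order Lipschitz; (3) $f$ is Lipschitz-open. Then $f$ is uniformly locally convex. Moreover, the local convexity radius of $f$ satisfies $$\mathrm{lcr}(f)\ \ge\ \frac{8\cdot \mathrm{Lip}_o(f)\cdot \mathrm{conv}_2(X)}{\mathrm{Lip}_2(f)}\ >\ 0 .$$
   Context: For a Banach space $X$, $B_\varepsilon(x)=\{y\in X:\|x-y\|<\varepsilon\}$ is the open ball, $B_X=\{x\in X:\|x\|\le 1\}$ the closed unit ball, $S_X=\{x\in X:\|x\|=1\}$ the unit sphere, and $[x,y]=\{tx+(1-t)y:t\in[0,1]\}$ the segment joining $x$ and $y$. Convexity of $X$: the modulus of convexity is $\delta_X(t)=\inf\{1-\|\tfrac{x+y}{2}\|: x,y\in S_X,\ \|x-y\|\ge t\}$ for $t\in[0,2]$. $X$ has modulus of convexity of power type 2 if there is $L>0$ with $\delta_X(t)\ge L t^2$ for all $t\in[0,2]$. The 2-convexity number of $X$ is $$\mathrm{conv}_2(X)=\inf\Big\{\frac{1-\|\frac{x+y}{2}\|}{\|x-y\|^2}: x,y\in B_X,\ x\ne y\Big\}.$$ Second order Lipschitz: for $f:U\to Y$ and $t>0$ put $\omega_2(f,t)=\sup\{\|f(x+h)-2f(x)+f(x-h)\|: h\in X,\ \|h\|\le t,\ [x-h,x+h]\subset U\}$, and $\mathrm{Lip}_2(f)=\sup_{t>0}\omega_2(f,t)/t^2$.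 The map $f$ is second order Lipschitz if $\mathrm{Lip}_2(f)<\infty$. Lipschitz-open: $\mathrm{Lip}_o(f)=\sup\{c\in[0,\infty): \forall x\in U\ \forall\varepsilon>0\ (B_\varepsilon(x)\subset U\Rightarrow B_{c\varepsilon}(f(x))\subset f(B_\varepsilon(x)))\}$. The map $f$ is Lipschitz-open if $\mathrm{Lip}_o(f)>0$, i.e. there is $c>0$ such that $B_{c\varepsilon}(f(x))\subset f(B_\varepsilon(x))$ whenever $x\in U$, $\varepsilon>0$ and $B_\varepsilon(x)\subset U$. Local convexity: for $x\in U$ the local convexity radius of $f$ at $x$ is $\mathrm{lcr}_x(f)=\sup\{c\in[0,+\infty):$ for every $0<\varepsilon\le c$ with $B_\varepsilon(x)\subset U$ the set $f(B_\varepsilon(x))$ is convex$\}$, and the local convexity radius of $f$ is $\mathrm{lcr}(f)=\inf_{x\in U}\mathrm{lcr}_x(f)$. The map $f$ is uniformly locally convex if $\mathrm{lcr}(f)>0$. Convention: the quotient in the bound is read as $+\infty$ when $\mathrm{Lip}_2(f)=0$ or $\mathrm{Lip}_o(f)=\infty$. *)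

theory Defs
  imports "HOL-Analysis.Analysis"
begin

text \<open>
  A map \<open>f : U \<rightarrow> Y\<close> is a total function together with its domain \<open>U\<close>; no definition below
  depends on values of \<open>f\<close> outside \<open>U\<close>.

  All suprema and infima are taken in \<open>[0, \<infinity>]\<close> (type \<^typ>\<open>ennreal\<close>), so the supremum of the
  empty set is 0 and the infimum of the empty set is \<open>\<infinity>\<close>. The real numbers coerced by
  \<^const>\<open>ennreal\<close> are nonnegative, so no truncation takes place.
\<close>

definition modulus_of_convexity :: "'a::real_normed_vector itself \<Rightarrow> real \<Rightarrow> ennreal" where
  "modulus_of_convexity _ t =
     Inf {ennreal (1 - norm ((x + y) /\<^sub>R 2)) | x y :: 'a.
            x \<in> sphere 0 1 \<and> y \<in> sphere 0 1 \<and> norm (x - y) \<ge> t}"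

definition convexity_power_type_2 :: "'a::real_normed_vector itself \<Rightarrow> bool" where
  "convexity_power_type_2 X \<longleftrightarrow>
     (\<exists>L::real. L > 0 \<and> (\<forall>t\<in>{0..2}. modulus_of_convexity X t \<ge> ennreal (L * t\<^sup>2)))"

definition conv2 :: "'a::real_normed_vector itself \<Rightarrow> ennreal" where
  "conv2 _ =
     Inf {ennreal ((1 - norm ((x + y) /\<^sub>R 2)) / (norm (x - y))\<^sup>2) | x y :: 'a.
            x \<in> cball 0 1 \<and> y \<in> cball 0 1 \<and> x \<noteq> y}"

definition omega2 ::
  "'a::real_normed_vector set \<Rightarrow> ('a \<Rightarrow> 'b::real_normed_vector) \<Rightarrow> real \<Rightarrow> ennreal" where
  "omega2 U f t =
     Sup {ennreal (norm (f (x + h) - 2 *\<^sub>R f x + f (x - h))) | x h.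
            norm h \<le> t \<and> closed_segment (x - h) (x + h) \<subseteq> U}"

definition Lip2 ::
  "'a::real_normed_vector set \<Rightarrow> ('a \<Rightarrow> 'b::real_normed_vector) \<Rightarrow> ennreal" where
  "Lip2 U f = (SUP t\<in>{0<..}. omega2 U f t / ennreal (t\<^sup>2))"

definition second_order_Lipschitz ::
  "'a::real_normed_vector set \<Rightarrow> ('a \<Rightarrow> 'b::real_normed_vector) \<Rightarrow> bool" where
  "second_order_Lipschitz U f \<longleftrightarrow> Lip2 U f < \<infinity>"

definition Lip_o ::
  "'a::real_normed_vector set \<Rightarrow> ('a \<Rightarrow> 'b::real_normed_vector) \<Rightarrow> ennreal" where
  "Lip_o U f =
     Sup {ennreal c | c. 0 \<le> c \<and>
       (\<forall>x\<in>U. \<forall>\<epsilon>>0. ball x \<epsilon> \<subseteq> U \<longrightarrow> ball (f x) (c * \<epsilon>) \<subseteq> f ` ball x \<epsilon>)}"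

definition Lipschitz_open ::
  "'a::real_normed_vector set \<Rightarrow> ('a \<Rightarrow> 'b::real_normed_vector) \<Rightarrow> bool" where
  "Lipschitz_open U f \<longleftrightarrow> Lip_o U f > 0"

definition lcr_at ::
  "'a::real_normed_vector set \<Rightarrow> ('a \<Rightarrow> 'b::real_normed_vector) \<Rightarrow> 'a \<Rightarrow> ennreal" where
  "lcr_at U f x =
     Sup {ennreal c | c. 0 \<le> c \<and>
       (\<forall>\<epsilon>. 0 < \<epsilon> \<and> \<epsilon> \<le> c \<and> ball x \<epsilon> \<subseteq> U \<longrightarrow> convex (f ` ball x \<epsilon>))}"

definition lcr ::
  "'a::real_normed_vector set \<Rightarrow> ('a \<Rightarrow> 'b::real_normed_vector) \<Rightarrow> ennreal" where
  "lcr U f = (INF x\<in>U. lcr_at U f x)"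

definition uniformly_locally_convex ::
  "'a::real_normed_vector set \<Rightarrow> ('a \<Rightarrow> 'b::real_normed_vector) \<Rightarrow> bool" where
  "uniformly_locally_convex U f \<longleftrightarrow> lcr U f > 0"

text \<open>
  The quotient \<open>8 Lip\<^sub>o(f) conv\<^sub>2(X) / Lip\<^sub>2(f)\<close>, read as \<open>\<infinity>\<close> when
  \<open>Lip\<^sub>2(f) = 0\<close> or \<open>Lip\<^sub>o(f) = \<infinity>\<close>.
\<close>

definition lcr_bound ::
  "'a::real_normed_vector set \<Rightarrow> ('a \<Rightarrow> 'b::real_normed_vector) \<Rightarrow> ennreal" where
  "lcr_bound U f =
     (if Lip2 U f = 0 \<or> Lip_o U f = \<infinity> then \<infinity>
      else 8 * Lip_o U f * conv2 TYPE('a) / Lip2 U f)"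

end

theory Submission
  imports Defs
begin

text \<open>
  Let \<open>a, b\<close> be two points of a ball \<open>B\<close> of radius \<open>\<epsilon>\<close> inside \<open>U\<close>, and let \<open>m\<close> be their
  midpoint and \<open>d\<close> their distance. The second order Lipschitz condition bounds the
  distance from \<open>f m\<close> to the midpoint of \<open>f a\<close> and \<open>f b\<close> by \<open>Lip\<^sub>2(f) d\<^sup>2 / 8\<close>. Uniform convexity
  of power type 2 leaves room around \<open>m\<close>: the ball of radius \<open>conv\<^sub>2(X) d\<^sup>2 / \<epsilon>\<close> at \<open>m\<close> still
  lies in \<open>B\<close>, so Lipschitz-openness puts a ball of radius about
  \<open>Lip\<^sub>o(f) conv\<^sub>2(X) d\<^sup>2 / \<epsilon>\<close> at \<open>f m\<close> into \<open>f(B)\<close>. Both radii are quadratic in \<open>d\<close>; the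
  second exceeds the first as soon as \<open>\<epsilon> < 8 Lip\<^sub>o(f) conv\<^sub>2(X) / Lip\<^sub>2(f)\<close>, and then the midpoint
  of \<open>f a\<close> and \<open>f b\<close> belongs to \<open>f(B)\<close> (lemma \<open>convex_image_ball\<close>).

  Hence \<open>f(B)\<close> is closed under midpoints. It is also open, since \<open>f\<close> is Lipschitz-open, and
  an open set closed under midpoints is convex (\<open>open_midpoint_convex_imp_convex\<close>).

  The bound is positive because \<open>conv\<^sub>2(X)\<close> is (\<open>conv2_pos\<close>). The modulus of convexity sees only
  pairs of unit vectors, whereas \<open>conv\<^sub>2(X)\<close> ranges over pairs in the whole unit ball, so the
  quadratic estimate has to be carried from the sphere to the ball
  (\<open>power_type_2_imp_unit_ball_bound\<close>).
\<close>

section \<open>Open sets closed under midpoints\<close>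

lemma dyadic_combination_mem_midpoint_convex:
  fixes C :: "'a::real_vector set"
  assumes mid: "\<And>a b. a \<in> C \<Longrightarrow> b \<in> C \<Longrightarrow> (1/2) *\<^sub>R (a + b) \<in> C"
    and "a \<in> C" "b \<in> C" "k \<le> 2 ^ n"
  shows "a + (real k / 2 ^ n) *\<^sub>R (b - a) \<in> C"
  using \<open>k \<le> 2 ^ n\<close>
proof (induction n arbitrary: k)
  case 0
  then have "k = 0 \<or> k = 1" by auto
  then show ?case using \<open>a \<in> C\<close> \<open>b \<in> C\<close> by auto
next
  case (Suc n)
  show ?case
  proof (cases "k \<le> 2 ^ n")
    case True
    have "(1/2) *\<^sub>R (a + (a + (real k / 2 ^ n) *\<^sub>R (b - a))) \<in> C"
      using mid \<open>a \<in> C\<close> Suc.IH[OF True] by blast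
    also have "(1/2) *\<^sub>R (a + (a + (real k / 2 ^ n) *\<^sub>R (b - a)))
        = a + (real k / 2 ^ Suc n) *\<^sub>R (b - a)"
    proof -
      have "(1/2) *\<^sub>R (a + (a + s *\<^sub>R (b - a))) = a + (s / 2) *\<^sub>R (b - a)" for s :: real
        by (simp add: scaleR_add_right flip: scaleR_left.add)
      from this[of "real k / 2 ^ n"] show ?thesis by (simp add: mult.commute)
    qed
    finally show ?thesis .
  next
    case False
    define j where "j = k - 2 ^ n"
    have j: "j \<le> 2 ^ n" "real k = 2 ^ n + real j"
      using False Suc.prems by (auto simp: j_def of_nat_diff)
    have "(1/2) *\<^sub>R (b + (a + (real j / 2 ^ n) *\<^sub>R (b - a))) \<in> C"
      using mid \<open>b \<in> C\<close> Suc.IH[OF j(1)] by blast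
    also have "(1/2) *\<^sub>R (b + (a + (real j / 2 ^ n) *\<^sub>R (b - a)))
        = a + (real k / 2 ^ Suc n) *\<^sub>R (b - a)"
    proof -
      have "(1/2) *\<^sub>R (b + (a + s *\<^sub>R (b - a))) = a + ((1 + s) / 2) *\<^sub>R (b - a)" for s :: real
      proof -
        have "a = (1/2) *\<^sub>R a + (1/2) *\<^sub>R a"
          by (simp flip: scaleR_left.add)
        then show ?thesis
          by (simp add: algebra_simps add_divide_distrib)
      qed
      moreover have "(1 + real j / 2 ^ n) / 2 = real k / 2 ^ Suc n"
        by (simp add: j(2) field_simps)
      ultimately show ?thesis by metis
    qed
    finally show ?thesis .
  qed
qed

text \<open>
  A point that divides \<open>[a, b]\<close> in the ratio given by \<open>t\<close> also divides \<open>[a', b]\<close> in a dyadic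
  ratio, for some \<open>a'\<close> near \<open>a\<close>: round \<open>t\<close> to a nearby dyadic number and move \<open>a\<close> to
  compensate. Openness keeps \<open>a'\<close> in the set, which reduces the claim to dyadic ratios.
\<close>
lemma open_midpoint_convex_imp_convex:
  fixes C :: "'a::real_normed_vector set"
  assumes "open C"
    and mid: "\<And>a b. a \<in> C \<Longrightarrow> b \<in> C \<Longrightarrow> (1/2) *\<^sub>R (a + b) \<in> C"
  shows "convex C"
  unfolding convex_alt
proof (intro ballI allI impI)
  fix a b and t :: real
  assume ab: "a \<in> C" "b \<in> C" and t: "0 \<le> t \<and> t \<le> 1"
  show "(1 - t) *\<^sub>R a + t *\<^sub>R b \<in> C"
  proof (cases "t = 1")
    case True
    then show ?thesis using ab by simp
  next
    case False
    define z where "z = (1 - t) *\<^sub>R a + t *\<^sub>R b"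
    define s where "s n = real (nat \<lfloor>2 ^ n * t\<rfloor>) / 2 ^ n" for n :: nat
    have s_eq: "s n = of_int \<lfloor>2 ^ n * t\<rfloor> / 2 ^ n" for n
      using t by (simp add: s_def)
    have s_le: "s n \<le> t" for n
      by (simp add: s_eq field_simps)
    have s_ge: "t - (1/2) ^ n \<le> s n" for n
    proof -
      have "2 ^ n * t - 1 \<le> of_int \<lfloor>2 ^ n * t\<rfloor>" by linarith
      then have "(2 ^ n * t - 1) / 2 ^ n \<le> s n"
        unfolding s_eq by (intro divide_right_mono) auto
      then show ?thesis by (simp add: diff_divide_distrib power_one_over)
    qed
    have s_lim: "s \<longlonglongrightarrow> t"
    proof (rule tendsto_sandwich)
      show "(\<lambda>n. t - (1/2) ^ n) \<longlonglongrightarrow> t"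
        using tendsto_diff[OF tendsto_const LIMSEQ_power_zero[of "1/2 :: real"]] by simp
      show "\<forall>\<^sub>F n in sequentially. t - (1/2) ^ n \<le> s n"
        by (rule always_eventually) (use s_ge in blast)
      show "\<forall>\<^sub>F n in sequentially. s n \<le> t"
        by (rule always_eventually) (use s_le in blast)
    qed (rule tendsto_const)
    \<comment> \<open>The point that replaces \<open>a\<close> when the weight \<open>t\<close> is rounded down to \<open>s n\<close>.\<close>
    define a' where "a' n = (1 / (1 - s n)) *\<^sub>R (z - s n *\<^sub>R b)" for n
    have "a' \<longlonglongrightarrow> (1 / (1 - t)) *\<^sub>R (z - t *\<^sub>R b)"
      unfolding a'_def using False by (intro tendsto_intros s_lim) auto
    also have "(1 / (1 - t)) *\<^sub>R (z - t *\<^sub>R b) = a"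
      using False by (simp add: z_def)
    finally have "eventually (\<lambda>n. a' n \<in> C) sequentially"
      using \<open>open C\<close> ab(1) topological_tendstoD by blast
    then obtain n where n: "a' n \<in> C"
      by (meson eventually_sequentially order_refl)
    have "2 ^ n * t \<le> 2 ^ n"
      using t by (simp add: mult_left_le)
    then have "\<lfloor>2 ^ n * t\<rfloor> \<le> \<lfloor>2 ^ n :: real\<rfloor>"
      by (rule floor_mono)
    also have "\<dots> = 2 ^ n"
      by (metis floor_of_int of_int_numeral of_int_power)
    finally have "nat \<lfloor>2 ^ n * t\<rfloor> \<le> 2 ^ n"
      by (simp add: nat_le_iff)
    from dyadic_combination_mem_midpoint_convex[OF mid n ab(2) this]
    have "a' n + s n *\<^sub>R (b - a' n) \<in> C"
      by (simp add: s_def)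
    also have "a' n + s n *\<^sub>R (b - a' n) = z"
    proof -
      have "s n \<noteq> 1" using s_le[of n] t False by linarith
      then have "(1 - s n) *\<^sub>R a' n = z - s n *\<^sub>R b"
        by (simp add: a'_def)
      then show ?thesis by (simp add: algebra_simps)
    qed
    finally show ?thesis by (simp add: z_def)
  qed
qed

section \<open>The 2-convexity number\<close>

text \<open>
  If the shorter vector has norm at most \<open>1 - d / 4\<close>, where \<open>d\<close> is the distance, the
  triangle inequality alone gains \<open>d / 8\<close> at the midpoint, and \<open>d / 8 \<ge> d\<^sup>2 / 16\<close> because
  \<open>d \<le> 2\<close>. Otherwise both vectors are so close to the sphere that after normalisation
  their distance is still at least \<open>d / 2\<close>, and the estimate on the sphere applies.
\<close>
lemma power_type_2_imp_unit_ball_bound: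
  assumes "convexity_power_type_2 TYPE('a::real_normed_vector)"
  obtains v :: real where "v > 0"
    and "\<And>x y :: 'a. norm x \<le> 1 \<Longrightarrow> norm y \<le> 1 \<Longrightarrow>
           norm ((x + y) /\<^sub>R 2) \<le> 1 - v * (norm (x - y))\<^sup>2"
proof -
  obtain L :: real where "L > 0"
    and L: "\<And>t. t \<in> {0..2} \<Longrightarrow> modulus_of_convexity TYPE('a) t \<ge> ennreal (L * t\<^sup>2)"
    using assms by (auto simp: convexity_power_type_2_def)
  have sphere: "norm ((x + y) /\<^sub>R 2) \<le> 1 - L * (norm (x - y))\<^sup>2"
    if "norm x = 1" "norm y = 1" for x y :: 'a
  proof -
    have "norm (x - y) \<le> 2" "norm (x + y) \<le> 2"
      using norm_triangle_ineq4[of x y] norm_triangle_ineq[of x y] that by auto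
    then have "ennreal (L * (norm (x - y))\<^sup>2) \<le> modulus_of_convexity TYPE('a) (norm (x - y))"
      by (intro L) auto
    also have "\<dots> \<le> ennreal (1 - norm ((x + y) /\<^sub>R 2))"
      unfolding modulus_of_convexity_def by (rule Inf_lower) (use that in auto)
    finally show ?thesis
      using \<open>norm (x + y) \<le> 2\<close> by (subst (asm) ennreal_le_iff) auto
  qed
  define v where "v = min (1/16) (L/8)"
  have v: "v > 0" "v \<le> 1/16" "v \<le> L/8"
    using \<open>L > 0\<close> by (auto simp: v_def)
  have ordered: "norm ((x + y) /\<^sub>R 2) \<le> 1 - v * (norm (x - y))\<^sup>2"
    if xy: "norm x \<le> 1" "norm y \<le> norm x" for x y :: 'a
  proof -
    define d where "d = norm (x - y)"
    have d: "0 \<le> d" "d \<le> 2"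
      using norm_triangle_ineq4[of x y] xy by (auto simp: d_def)
    show ?thesis
    proof (cases "norm y \<le> 1 - d / 4")
      case True
      have "norm ((x + y) /\<^sub>R 2) \<le> (norm x + norm y) / 2"
        using norm_triangle_ineq[of x y] by simp
      also have "\<dots> \<le> 1 - d / 8"
        using True xy by simp
      also have "\<dots> \<le> 1 - v * d\<^sup>2"
      proof -
        have "v * d\<^sup>2 \<le> (1/16) * (2 * d)"
          using d v by (intro mult_mono) (auto simp: power2_eq_square mult_right_mono)
        then show ?thesis by simp
      qed
      finally show ?thesis by (simp add: d_def)
    next
      case False
      define r s where "r = norm x" and "s = norm y"
      have rs: "1/2 \<le> s" "s \<le> r" "r \<le> 1" "1 - d / 4 < s"
        using False xy d by (auto simp: r_def s_def)
      define x' y' where "x' = x /\<^sub>R r" and "y' = y /\<^sub>R s"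
      have "r \<noteq> 0" "s \<noteq> 0" using rs by auto
      then have x': "norm x' = 1" "x = r *\<^sub>R x'" and y': "norm y' = 1" "y = s *\<^sub>R y'"
        by (auto simp: x'_def y'_def r_def s_def)
      have "d / 2 \<le> norm (x' - y')"
      proof -
        have "x - y = (x' - y') - (1 - r) *\<^sub>R x' + (1 - s) *\<^sub>R y'"
          by (simp add: x'(2) y'(2) algebra_simps)
        then have "d \<le> norm ((x' - y') - (1 - r) *\<^sub>R x') + norm ((1 - s) *\<^sub>R y')"
          unfolding d_def by (metis norm_triangle_ineq)
        also have "\<dots> \<le> norm (x' - y') + norm ((1 - r) *\<^sub>R x') + norm ((1 - s) *\<^sub>R y')"
          using norm_triangle_ineq4 add_right_mono by blast
        finally show ?thesis using rs x'(1) y'(1) by simp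
      qed
      then have "(d / 2)\<^sup>2 \<le> (norm (x' - y'))\<^sup>2"
        using d by (intro power_mono) auto
      then have "L * (d / 2)\<^sup>2 \<le> L * (norm (x' - y'))\<^sup>2"
        using \<open>L > 0\<close> by simp
      then have m: "norm ((x' + y') /\<^sub>R 2) \<le> 1 - L * (d / 2)\<^sup>2"
        using sphere[OF x'(1) y'(1)] by linarith
      \<comment> \<open>Shrinking both unit vectors to the smaller norm \<open>s\<close> loses nothing of the gain but the
        factor \<open>s \<ge> 1/2\<close>; the rest of \<open>x\<close> points along \<open>x'\<close>.\<close>
      have "(x + y) /\<^sub>R 2 = s *\<^sub>R ((x' + y') /\<^sub>R 2) + ((r - s) / 2) *\<^sub>R x'"
        by (simp add: x'(2) y'(2) algebra_simps diff_divide_distrib)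
      then have "norm ((x + y) /\<^sub>R 2)
          \<le> norm (s *\<^sub>R ((x' + y') /\<^sub>R 2)) + norm (((r - s) / 2) *\<^sub>R x')"
        by (metis norm_triangle_ineq)
      also have "\<dots> = s * norm ((x' + y') /\<^sub>R 2) + (r - s) / 2"
        using rs x'(1) by simp
      also have "\<dots> \<le> s * (1 - L * (d / 2)\<^sup>2) + (r - s) / 2"
        using m rs by (intro add_right_mono mult_left_mono) auto
      also have "\<dots> \<le> 1 - v * d\<^sup>2"
      proof -
        define q where "q = L * (d / 2)\<^sup>2"
        have "s * (1 - q) + (r - s) / 2 \<le> (s - q / 2) + (r - s) / 2"
          using mult_right_mono[OF rs(1), of q] \<open>L > 0\<close>
          by (simp add: q_def right_diff_distrib)
        also have "\<dots> \<le> 1 - q / 2"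
          using rs(2,3) by (simp add: field_simps)
        also have "\<dots> \<le> 1 - v * d\<^sup>2"
          using mult_right_mono[OF v(3), of "d\<^sup>2"] by (simp add: q_def power_divide)
        finally show ?thesis by (simp add: q_def)
      qed
      finally show ?thesis by (simp add: d_def)
    qed
  qed
  have "norm ((x + y) /\<^sub>R 2) \<le> 1 - v * (norm (x - y))\<^sup>2"
    if "norm x \<le> 1" "norm y \<le> 1" for x y :: 'a
    using ordered[of x y] ordered[of y x] that
    by (cases "norm y \<le> norm x") (auto simp: add.commute norm_minus_commute)
  with \<open>v > 0\<close> show thesis using that by blast
qed

lemma conv2_pos:
  assumes "convexity_power_type_2 TYPE('a::real_normed_vector)"
  shows "conv2 TYPE('a) > 0"
proof -
  obtain v :: real where v: "v > 0"
    "\<And>x y :: 'a. norm x \<le> 1 \<Longrightarrow> norm y \<le> 1 \<Longrightarrow>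
           norm ((x + y) /\<^sub>R 2) \<le> 1 - v * (norm (x - y))\<^sup>2"
    using power_type_2_imp_unit_ball_bound[OF assms] by blast
  have "ennreal v \<le> conv2 TYPE('a)"
    unfolding conv2_def
  proof (rule Inf_greatest, clarify)
    fix x y :: 'a
    assume "x \<in> cball 0 1" "y \<in> cball 0 1" "x \<noteq> y"
    then have "v * (norm (x - y))\<^sup>2 \<le> 1 - norm ((x + y) /\<^sub>R 2)"
      using v(2)[of x y] by auto
    then have "v \<le> (1 - norm ((x + y) /\<^sub>R 2)) / (norm (x - y))\<^sup>2"
      using \<open>x \<noteq> y\<close> by (subst pos_le_divide_eq) auto
    then show "ennreal v \<le> ennreal ((1 - norm ((x + y) /\<^sub>R 2)) / (norm (x - y))\<^sup>2)"
      by (rule ennreal_leI)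
  qed
  with v(1) show ?thesis
    by (metis ennreal_less_zero_iff less_le_trans)
qed

lemma midpoint_norm_le_conv2:
  fixes a b :: "'a::real_normed_vector"
  assumes v: "0 \<le> v" "ennreal v \<le> conv2 TYPE('a)"
    and "0 < r" "norm a \<le> r" "norm b \<le> r"
  shows "norm ((a + b) /\<^sub>R 2) \<le> r - v * (norm (a - b))\<^sup>2 / r"
proof (cases "a = b")
  case True
  then show ?thesis using assms by (simp flip: scaleR_2)
next
  case False
  define x y where "x = a /\<^sub>R r" and "y = b /\<^sub>R r"
  have xy: "norm x \<le> 1" "norm y \<le> 1" "x \<noteq> y" "a = r *\<^sub>R x" "b = r *\<^sub>R y"
    using assms False by (auto simp: x_def y_def field_simps)
  have n2: "norm ((x + y) /\<^sub>R 2) \<le> 1"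
    using norm_triangle_ineq[of x y] xy by simp
  have "ennreal v \<le> ennreal ((1 - norm ((x + y) /\<^sub>R 2)) / (norm (x - y))\<^sup>2)"
    by (rule order.trans[OF v(2)], unfold conv2_def, rule Inf_lower)
      (use xy in auto)
  then have "v \<le> (1 - norm ((x + y) /\<^sub>R 2)) / (norm (x - y))\<^sup>2"
    using n2 by (subst (asm) ennreal_le_iff) auto
  then have "norm ((x + y) /\<^sub>R 2) \<le> 1 - v * (norm (x - y))\<^sup>2"
    using xy by (subst (asm) pos_le_divide_eq) auto
  then have "r * norm ((x + y) /\<^sub>R 2) \<le> r * (1 - v * (norm (x - y))\<^sup>2)"
    using \<open>0 < r\<close> by simp
  moreover have "norm ((a + b) /\<^sub>R 2) = r * norm ((x + y) /\<^sub>R 2)"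
    using \<open>0 < r\<close> by (simp add: xy flip: scaleR_add_right)
  moreover have "norm (a - b) = r * norm (x - y)"
    using \<open>0 < r\<close> by (simp add: xy flip: scaleR_diff_right)
  ultimately show ?thesis
    using \<open>0 < r\<close> by (simp add: field_simps power2_eq_square)
qed

section \<open>Convexity of the images of balls\<close>

lemma second_difference_le_Lip2:
  fixes f :: "'a::real_normed_vector \<Rightarrow> 'b::real_normed_vector"
  assumes "Lip2 U f \<le> ennreal L" "0 \<le> L" "closed_segment (x - h) (x + h) \<subseteq> U"
  shows "norm (f (x + h) - 2 *\<^sub>R f x + f (x - h)) \<le> L * (norm h)\<^sup>2"
proof (cases "h = 0")
  case True
  then show ?thesis by (simp add: scaleR_2)
next
  case False
  let ?N = "norm (f (x + h) - 2 *\<^sub>R f x + f (x - h))"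
  have "ennreal (?N / (norm h)\<^sup>2) = ennreal ?N / ennreal ((norm h)\<^sup>2)"
    using False by (simp add: divide_ennreal)
  also have "\<dots> \<le> omega2 U f (norm h) / ennreal ((norm h)\<^sup>2)"
    unfolding omega2_def using assms(3)
    by (intro divide_right_mono_ennreal Sup_upper) blast
  also have "\<dots> \<le> Lip2 U f"
    unfolding Lip2_def using False by (intro SUP_upper) auto
  also have "\<dots> \<le> ennreal L" by fact
  finally show ?thesis
    using False \<open>0 \<le> L\<close> by (simp add: pos_divide_le_eq)
qed

text \<open>
  The reals \<open>L\<close>, \<open>c\<close>, \<open>v\<close> stand in for \<open>Lip\<^sub>2(f)\<close>, \<open>Lip\<^sub>o(f)\<close>, \<open>conv\<^sub>2(X)\<close>; the last two may be
  infinite. The inequality between them is strict because the midpoint of \<open>f a\<close> and \<open>f b\<close>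
  must fall into the open ball that Lipschitz-openness provides at \<open>f m\<close>.
\<close>
lemma convex_image_ball:
  fixes f :: "'a::real_normed_vector \<Rightarrow> 'b::real_normed_vector"
  assumes lip: "\<And>x h. closed_segment (x - h) (x + h) \<subseteq> U \<Longrightarrow>
        norm (f (x + h) - 2 *\<^sub>R f x + f (x - h)) \<le> L * (norm h)\<^sup>2"
    and opn: "\<And>x \<epsilon>. x \<in> U \<Longrightarrow> \<epsilon> > 0 \<Longrightarrow> ball x \<epsilon> \<subseteq> U \<Longrightarrow>
        ball (f x) (c * \<epsilon>) \<subseteq> f ` ball x \<epsilon>"
    and v: "0 < v" "ennreal v \<le> conv2 TYPE('a)"
    and c: "0 < c" and small: "\<epsilon> * L < 8 * c * v"
    and ball: "0 < \<epsilon>" "ball x \<epsilon> \<subseteq> U"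
  shows "convex (f ` ball x \<epsilon>)"
proof (rule open_midpoint_convex_imp_convex)
  show "open (f ` ball x \<epsilon>)"
    unfolding open_contains_ball
  proof clarify
    fix p assume "p \<in> ball x \<epsilon>"
    then obtain \<eta> where \<eta>: "\<eta> > 0" "ball p \<eta> \<subseteq> ball x \<epsilon>"
      using open_contains_ball by blast
    then have "ball (f p) (c * \<eta>) \<subseteq> f ` ball x \<epsilon>"
      using opn[of p \<eta>] ball(2) by (smt (verit) centre_in_ball image_mono subset_iff)
    then show "\<exists>e>0. ball (f p) e \<subseteq> f ` ball x \<epsilon>"
      using c \<eta>(1) by (intro exI[of _ "c * \<eta>"]) auto
  qed
next
  fix p q assume "p \<in> f ` ball x \<epsilon>" "q \<in> f ` ball x \<epsilon>"
  then obtain a b where ab: "a \<in> ball x \<epsilon>" "b \<in> ball x \<epsilon>" "p = f a" "q = f b"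
    by blast
  show "(1/2) *\<^sub>R (p + q) \<in> f ` ball x \<epsilon>"
  proof (cases "a = b")
    case True
    then show ?thesis using ab by (auto simp flip: scaleR_2)
  next
    case False
    define m h d where "m = (1/2) *\<^sub>R (a + b)" and "h = (1/2) *\<^sub>R (a - b)" and "d = norm (a - b)"
    have mh: "m + h = a" "m - h = b"
      by (simp_all add: m_def h_def algebra_simps flip: scaleR_left.add)
    have "d > 0" using False by (simp add: d_def)
    \<comment> \<open>The room that uniform convexity leaves around the midpoint \<open>m\<close>.\<close>
    define \<delta> where "\<delta> = v * d\<^sup>2 / \<epsilon>"
    have "\<delta> > 0" using v ball \<open>d > 0\<close> by (simp add: \<delta>_def)
    have "norm (((a - x) + (b - x)) /\<^sub>R 2) \<le> \<epsilon> - v * (norm ((a - x) - (b - x)))\<^sup>2 / \<epsilon>"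
      using ab v ball by (intro midpoint_norm_le_conv2) (auto simp: dist_norm norm_minus_commute)
    moreover have "((a - x) + (b - x)) /\<^sub>R 2 = m - x"
      by (simp add: m_def algebra_simps flip: scaleR_left.add)
    moreover have "(a - x) - (b - x) = a - b" by simp
    ultimately have m_room: "dist x m \<le> \<epsilon> - \<delta>"
      by (simp only: d_def \<delta>_def dist_norm norm_minus_commute[of x m])
    have sub: "ball m \<delta> \<subseteq> ball x \<epsilon>"
    proof
      fix y assume "y \<in> ball m \<delta>"
      then show "y \<in> ball x \<epsilon>"
        using m_room dist_triangle[of x y m] by auto
    qed
    have "closed_segment (m - h) (m + h) \<subseteq> U"
      unfolding mh using closed_segment_subset[OF ab(2,1) convex_ball] ball(2) by blast
    moreover have "norm h = d / 2"
      by (simp add: h_def d_def)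
    ultimately have "norm (p - 2 *\<^sub>R f m + q) \<le> L * (d / 2)\<^sup>2"
      using lip[of m h] unfolding mh ab by metis
    moreover have "f m - (1/2) *\<^sub>R (p + q) = (-1/2) *\<^sub>R (p - 2 *\<^sub>R f m + q)"
      by (simp add: algebra_simps)
    ultimately have "dist (f m) ((1/2) *\<^sub>R (p + q)) \<le> L * d\<^sup>2 / 8"
      by (simp add: dist_norm power_divide)
    also have "\<dots> < c * \<delta>"
    proof -
      have "\<epsilon> * L * d\<^sup>2 < 8 * c * v * d\<^sup>2"
        using small \<open>d > 0\<close> by simp
      then show ?thesis using ball(1) by (simp add: \<delta>_def field_simps)
    qed
    finally have "(1/2) *\<^sub>R (p + q) \<in> ball (f m) (c * \<delta>)" by simp
    also have "\<dots> \<subseteq> f ` ball m \<delta>"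
    proof (rule opn)
      show sub_U: "ball m \<delta> \<subseteq> U" using sub ball(2) by (rule order.trans)
      show "m \<in> U" using sub_U \<open>\<delta> > 0\<close> centre_in_ball by blast
    qed fact
    also have "\<dots> \<subseteq> f ` ball x \<epsilon>" using sub by blast
    finally show ?thesis .
  qed
qed

text \<open>
  Below the bound there is slack, which leaves space to replace the supremum \<open>Lip\<^sub>o(f)\<close> and
  the possibly infinite \<open>conv\<^sub>2(X)\<close> by real constants. The constant \<open>v\<close> is chosen first, so
  that what remains is one strict inequality below the supremum \<open>Lip\<^sub>o(f)\<close>.
\<close>
lemma lcr_bound_le_lcr:
  fixes f :: "'a::real_normed_vector \<Rightarrow> 'b::real_normed_vector"
  assumes "Lip2 U f < \<infinity>" and o_pos: "Lip_o U f > 0" and conv_pos: "conv2 TYPE('a) > 0"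
  shows "lcr_bound U f \<le> lcr U f"
  unfolding lcr_def
proof (rule INF_greatest, rule dense_le)
  fix x y assume "y < lcr_bound U f"
  then obtain K where K: "0 \<le> K" "y = ennreal K"
    by (cases y) auto
  obtain L where L: "0 \<le> L" "Lip2 U f = ennreal L"
    using assms(1) by (cases "Lip2 U f") auto
  obtain v0 where v0: "0 < v0" "ennreal v0 \<le> conv2 TYPE('a)"
  proof (cases "conv2 TYPE('a)")
    case (real C)
    then show thesis using that[of C] conv_pos by simp
  next
    case top
    then show thesis using that[of 1] by simp
  qed
  obtain v where v: "0 < v" "ennreal v \<le> conv2 TYPE('a)" "ennreal (K * L / (8 * v)) < Lip_o U f"
  proof (cases "L = 0 \<or> Lip_o U f = \<infinity>")
    case True
    then have "ennreal (K * L / (8 * v0)) < Lip_o U f"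
      using o_pos by auto
    with v0 that show thesis by blast
  next
    case False
    then obtain M where M: "0 < M" "Lip_o U f = ennreal M"
      using o_pos by (cases "Lip_o U f") auto
    have "L > 0" using False L(1) by simp
    show thesis
    proof (cases "conv2 TYPE('a)")
      case (real C)
      have "C > 0" using conv_pos real by simp
      have "8 * ennreal M * ennreal C = ennreal (8 * M * C)"
        using \<open>C > 0\<close> M(1) by (simp add: ennreal_mult)
      then have "8 * ennreal M * ennreal C / ennreal L = ennreal (8 * M * C / L)"
        using \<open>L > 0\<close> \<open>C > 0\<close> M(1) by (simp add: divide_ennreal)
      then have "ennreal K < ennreal (8 * M * C / L)"
        using \<open>y < lcr_bound U f\<close> False L M K real \<open>L > 0\<close> by (simp add: lcr_bound_def)
      then have "K < 8 * M * C / L"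
        using K(1) by (simp add: ennreal_less_iff)
      then have "K * L / (8 * C) < M"
        using \<open>L > 0\<close> \<open>C > 0\<close> by (simp add: field_simps)
      then show thesis
        using that[of C] real \<open>C > 0\<close> M by (simp add: ennreal_lessI)
    next
      case top
      define v where "v = K * L / (8 * M) + 1"
      have "v > 0" using K(1) L(1) M(1) by (simp add: v_def add_nonneg_pos)
      moreover have "K * L / (8 * v) < M"
        using \<open>v > 0\<close> M(1) by (simp add: v_def field_simps)
      ultimately show thesis
        using that[of v] top M by (simp add: ennreal_lessI)
    qed
  qed
  then obtain c where c: "0 \<le> c" "ennreal (K * L / (8 * v)) < ennreal c"
    and opn: "\<forall>x\<in>U. \<forall>\<epsilon>>0. ball x \<epsilon> \<subseteq> U \<longrightarrow> ball (f x) (c * \<epsilon>) \<subseteq> f ` ball x \<epsilon>"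
    unfolding Lip_o_def less_Sup_iff by blast
  have quot: "0 \<le> K * L / (8 * v)" "K * L / (8 * v) < c"
    using c K(1) L(1) v(1) by (auto simp: ennreal_less_iff)
  then have "0 < c" "K * L < 8 * c * v"
    using v(1) by (linarith, simp add: field_simps)
  have "convex (f ` ball x \<epsilon>)" if "0 < \<epsilon>" "\<epsilon> \<le> K" "ball x \<epsilon> \<subseteq> U" for \<epsilon>
  proof (rule convex_image_ball[OF second_difference_le_Lip2 _ v(1,2) \<open>0 < c\<close> _ that(1,3)])
    show "\<epsilon> * L < 8 * c * v"
      using \<open>K * L < 8 * c * v\<close> mult_right_mono[OF that(2) L(1)] by linarith
  qed (use L opn in auto)
  then show "y \<le> lcr_at U f x"
    unfolding lcr_at_def using K by (intro Sup_upper) auto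
qed

theorem theorem4p1:
  fixes U :: "'a::banach set"
    and f :: "'a \<Rightarrow> 'b::banach"
  assumes "open U"
    and "convexity_power_type_2 TYPE('a)"
    and "second_order_Lipschitz U f"
    and "Lipschitz_open U f"
  shows "uniformly_locally_convex U f \<and> lcr U f \<ge> lcr_bound U f \<and> lcr_bound U f > 0"
proof -
  have finite: "Lip2 U f < \<infinity>" and o_pos: "Lip_o U f > 0" and conv_pos: "conv2 TYPE('a) > 0"
    using assms conv2_pos by (auto simp: second_order_Lipschitz_def Lipschitz_open_def)
  have "lcr_bound U f \<le> lcr U f"
    using finite o_pos conv_pos by (rule lcr_bound_le_lcr)
  moreover have "lcr_bound U f > 0"
    using finite o_pos conv_pos
    by (auto simp: lcr_bound_def ennreal_zero_less_divide ennreal_zero_less_mult_iff)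
  ultimately show ?thesis
    unfolding uniformly_locally_convex_def using less_le_trans by blast
qed

end
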